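(* Let $k$ be an algebraically closed field of characteristic zero, let $B$ be a finitely generated $k$-domain, and let $\varphi$ be a $k$-algebra automorphism of $B$. If $D$ is a semisimple $k$-derivation of $B$, then $\varphi D\varphi^{-1}$ is a semisimple $k$-derivation of $B$.
   Context: A $k$-derivation $D$ of $B$ is called semisimple if $B$ is the direct sum of the eigenspaces of $D$, i.e. $B=\bigoplus_{\lambda\in k}\{b\in B\mid D(b)=\lambda b\}$. *)

theory Defs
  imports "HOL-Computational_Algebra.Polynomial"
begin

locale commutative_algebra = vector_space scale
  for scale :: "'k::field \<Rightarrow> 'b::comm_ring_1 \<Rightarrow> 'b" (infixr \<open>*s\<close> 75) +
  assumes scale_mult_left: "(c *s x) * y = c *s (x * y)"
begin

definition subalgebra :: "'b set \<Rightarrow> bool" where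
  "subalgebra A \<longleftrightarrow> subspace A \<and> 1 \<in> A \<and> (\<forall>x\<in>A. \<forall>y\<in>A. x * y \<in> A)"

definition finitely_generated :: bool where
  "finitely_generated \<longleftrightarrow> (\<exists>S. finite S \<and> subalgebra hull S = UNIV)"

definition algebra_automorphism :: "('b \<Rightarrow> 'b) \<Rightarrow> bool" where
  "algebra_automorphism \<phi> \<longleftrightarrow>
     bij \<phi> \<and> Vector_Spaces.linear scale scale \<phi> \<and> \<phi> 1 = 1 \<and> (\<forall>x y. \<phi> (x * y) = \<phi> x * \<phi> y)"

definition derivation :: "('b \<Rightarrow> 'b) \<Rightarrow> bool" where
  "derivation D \<longleftrightarrow>
     Vector_Spaces.linear scale scale D \<and> (\<forall>x y. D (x * y) = x * D y + D x * y)"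

definition eigenspace :: "('b \<Rightarrow> 'b) \<Rightarrow> 'k \<Rightarrow> 'b set" where
  "eigenspace D c = {b. D b = c *s b}"

(* Internal direct sum of a possibly infinite family of subspaces: every element is the sum
   of a unique finitely supported family of components. *)
definition is_direct_sum :: "('i \<Rightarrow> 'b set) \<Rightarrow> bool" where
  "is_direct_sum V \<longleftrightarrow>
     (\<forall>i. subspace (V i)) \<and>
     (\<forall>b. \<exists>!f. (\<forall>i. f i \<in> V i) \<and> finite {i. f i \<noteq> 0} \<and> b = (\<Sum>i | f i \<noteq> 0. f i))"

(* The family is indexed by all scalars; those that are not eigenvalues contribute the
   zero subspace. *)
definition semisimple_derivation :: "('b \<Rightarrow> 'b) \<Rightarrow> bool" where
  "semisimple_derivation D \<longleftrightarrow> derivation D \<and> is_direct_sum (eigenspace D)"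

end

end

theory Submission
  imports Defs
begin

text \<open>Conjugation by \<open>\<phi>\<close> is a change of coordinates, so it preserves both
  halves of semisimplicity. The Leibniz rule survives because \<open>\<phi>\<close> and
  \<open>inv \<phi>\<close> are multiplicative (\<open>derivation_conjugate\<close>). The conjugate
  has the same eigenvalues as \<open>D\<close>, its eigenspaces being the images under
  \<open>\<phi>\<close> of those of \<open>D\<close> (\<open>eigenspace_conjugate\<close>), and a
  linear bijection carries a direct sum decomposition to a direct sum decomposition
  (\<open>is_direct_sum_linear_image\<close>).\<close>

context commutative_algebra
begin

lemma subspace_linear_image:
  assumes "Vector_Spaces.linear scale scale \<phi>" and "subspace V"
  shows "subspace (\<phi> ` V)"
proof -
  interpret \<phi>: Vector_Spaces.linear scale scale \<phi> by fact
  show ?thesis by (rule \<phi>.subspace_image[OF assms(2)])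
qed

lemma linear_inv:
  assumes "Vector_Spaces.linear scale scale \<phi>" and "bij \<phi>"
  shows "Vector_Spaces.linear scale scale (inv \<phi>)"
proof -
  interpret \<phi>: Vector_Spaces.linear scale scale \<phi> by fact
  have *: "inv \<phi> (\<phi> x) = x" "\<phi> (inv \<phi> x) = x" for x
    using assms(2) by (simp_all add: bij_is_inj bij_is_surj surj_f_inv_f)
  show ?thesis
  proof unfold_locales
    show "inv \<phi> (x + y) = inv \<phi> x + inv \<phi> y" for x y
      by (metis * \<phi>.add)
    show "inv \<phi> (c *s x) = c *s inv \<phi> x" for c x
      by (metis * \<phi>.scale)
  qed
qed

text \<open>Component families correspond: \<open>f\<close> decomposes \<open>inv \<phi> b\<close>
  along \<open>V\<close> exactly when \<open>\<phi> \<circ> f\<close> decomposes \<open>b\<close>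
  along the images, so existence and uniqueness both transfer.\<close>

lemma is_direct_sum_linear_image:
  assumes lin: "Vector_Spaces.linear scale scale \<phi>" and bij: "bij \<phi>"
    and V: "is_direct_sum V"
  shows "is_direct_sum (\<lambda>i. \<phi> ` V i)"
proof -
  interpret \<phi>: Vector_Spaces.linear scale scale \<phi> by fact
  interpret \<psi>: Vector_Spaces.linear scale scale "inv \<phi>"
    using lin bij by (rule linear_inv)
  have inv: "inv \<phi> (\<phi> x) = x" "\<phi> (inv \<phi> x) = x" for x
    using bij by (simp_all add: bij_is_inj bij_is_surj surj_f_inv_f)
  \<comment> \<open>Applying either map componentwise thus leaves the support of a family unchanged,
    so finiteness and the index set of the sum carry over.\<close>
  have zero: "\<phi> x = 0 \<longleftrightarrow> x = 0" "inv \<phi> x = 0 \<longleftrightarrow> x = 0" for x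
    by (metis inv \<phi>.zero)+
  let ?dec = "\<lambda>V b f. (\<forall>i. f i \<in> V i) \<and> finite {i. f i \<noteq> 0} \<and> b = (\<Sum>i | f i \<noteq> 0. f i)"
  have "\<exists>!f. ?dec (\<lambda>i. \<phi> ` V i) b f" for b
  proof -
    from V have "\<exists>!f. ?dec V (inv \<phi> b) f"
      by (simp add: is_direct_sum_def)
    then obtain f where f: "?dec V (inv \<phi> b) f"
      and uniq: "\<And>g. ?dec V (inv \<phi> b) g \<Longrightarrow> g = f" by blast
    have "b = \<phi> (\<Sum>i | f i \<noteq> 0. f i)" using f inv(2) by metis
    then have "?dec (\<lambda>i. \<phi> ` V i) b (\<phi> \<circ> f)"
      using f by (simp add: inv zero \<phi>.sum)
    \<comment> \<open>Uniqueness: pulling \<open>g\<close> back along \<open>inv \<phi>\<close>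
      gives a decomposition of \<open>inv \<phi> b\<close>, which can only be
      \<open>f\<close>.\<close>
    moreover have "g = \<phi> \<circ> f" if g: "?dec (\<lambda>i. \<phi> ` V i) b g" for g
    proof -
      have "inv \<phi> (g i) \<in> V i" for i
        using g by (metis imageE inv(1))
      moreover have "inv \<phi> b = (\<Sum>i | g i \<noteq> 0. inv \<phi> (g i))"
        using g \<psi>.sum by metis
      ultimately have "?dec V (inv \<phi> b) (inv \<phi> \<circ> g)"
        using g by (simp add: zero)
      then have "inv \<phi> \<circ> g = f" by (rule uniq)
      then show ?thesis by (auto simp: inv)
    qed
    ultimately show ?thesis by blast
  qed
  then show ?thesis
    using V subspace_linear_image[OF lin] unfolding is_direct_sum_def by blast
qed

text \<open>The conjugate sends \<open>\<phi> a\<close> to \<open>\<phi> (D a)\<close>, and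
  \<open>\<phi>\<close> commutes with scalars and is injective, so \<open>a\<close> and
  \<open>\<phi> a\<close> satisfy the eigenvector equation for the same \<open>c\<close>.\<close>

lemma eigenspace_conjugate:
  assumes lin: "Vector_Spaces.linear scale scale \<phi>" and bij: "bij \<phi>"
  shows "eigenspace (\<phi> \<circ> D \<circ> inv \<phi>) c = \<phi> ` eigenspace D c"
proof -
  interpret \<phi>: Vector_Spaces.linear scale scale \<phi> by fact
  have inv: "inv \<phi> (\<phi> x) = x" "\<phi> (inv \<phi> x) = x" for x
    using bij by (simp_all add: bij_is_inj bij_is_surj surj_f_inv_f)
  have "b \<in> \<phi> ` eigenspace D c" if "\<phi> (D (inv \<phi> b)) = c *s b" for b
  proof
    show "b = \<phi> (inv \<phi> b)" by (simp add: inv)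
    show "inv \<phi> b \<in> eigenspace D c"
      unfolding eigenspace_def using that by (metis (mono_tags) inv \<phi>.scale mem_Collect_eq)
  qed
  then show ?thesis
    by (auto simp: eigenspace_def inv \<phi>.scale)
qed

lemma derivation_conjugate:
  assumes \<phi>: "algebra_automorphism \<phi>" and D: "derivation D"
  shows "derivation (\<phi> \<circ> D \<circ> inv \<phi>)"
proof -
  have lin: "Vector_Spaces.linear scale scale \<phi>" and bij: "bij \<phi>"
    and mult: "\<And>x y. \<phi> (x * y) = \<phi> x * \<phi> y"
    using \<phi> by (auto simp: algebra_automorphism_def)
  interpret \<phi>: Vector_Spaces.linear scale scale \<phi> by (fact lin)
  have inv: "inv \<phi> (\<phi> x) = x" "\<phi> (inv \<phi> x) = x" for x
    using bij by (simp_all add: bij_is_inj bij_is_surj surj_f_inv_f)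
  \<comment> \<open>Both sides have image \<open>x * y\<close> under the injective map
    \<open>\<phi>\<close>.\<close>
  have inv_mult: "inv \<phi> (x * y) = inv \<phi> x * inv \<phi> y" for x y
    by (metis inv mult)
  have "Vector_Spaces.linear scale scale (\<phi> \<circ> D \<circ> inv \<phi>)"
    using D lin linear_inv[OF lin bij]
    by (auto simp: derivation_def intro: Vector_Spaces.linear_compose)
  \<comment> \<open>For the product rule, apply that of \<open>D\<close> to
    \<open>inv \<phi> x\<close> and \<open>inv \<phi> y\<close>, then push through
    \<open>\<phi>\<close>; the undifferentiated factors return to \<open>x\<close> and
    \<open>y\<close>.\<close>
  then show ?thesis
    using D by (simp add: derivation_def inv_mult \<phi>.add mult inv)
qed

end

theorem proposition2p6:
  fixes scale :: "'k::{alg_closed_field, field_char_0} \<Rightarrow> 'b::idom \<Rightarrow> 'b"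
    and \<phi> D :: "'b \<Rightarrow> 'b"
  assumes "commutative_algebra scale"
    and "commutative_algebra.finitely_generated scale"
    and "commutative_algebra.algebra_automorphism scale \<phi>"
    and "commutative_algebra.semisimple_derivation scale D"
  shows "commutative_algebra.semisimple_derivation scale (\<phi> \<circ> D \<circ> inv \<phi>)"
proof -
  interpret commutative_algebra scale by fact
  have lin: "Vector_Spaces.linear scale scale \<phi>" and bij: "bij \<phi>"
    using assms(3) by (auto simp: algebra_automorphism_def)
  have D: "derivation D" "is_direct_sum (eigenspace D)"
    using assms(4) by (auto simp: semisimple_derivation_def)
  \<comment> \<open>Stated as an equality of whole families, since \<open>is_direct_sum\<close>
    takes the indexed family as its argument.\<close>
  have "eigenspace (\<phi> \<circ> D \<circ> inv \<phi>) = (\<lambda>c. \<phi> ` eigenspace D c)"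
    using eigenspace_conjugate[OF lin bij] by blast
  then show ?thesis
    using derivation_conjugate[OF assms(3) D(1)] is_direct_sum_linear_image[OF lin bij D(2)]
    by (simp add: semisimple_derivation_def)
qed

end
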